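(* Let $(\mathbf A_n)_{n\in\mathbb N}$ be a strongly polynomial sequence of $\kappa$-structures and let $I=(p,\varpi,\rho_0,\dots,\rho_q)$ be a general interpretation scheme of $\lambda$-structures in $\kappa$-structures such that all the formulas $\varpi,\rho_0,\dots,\rho_q$ are quantifier-free. Assume that there exist an integer $N$, polynomials $Q_1,\dots,Q_N$ with $Q_i(n)\in\mathbb N$ for every $1\le i\le N$ and $n\in\mathbb N$, and quantifier-free $\kappa$-formulas $\eta_1,\dots,\eta_N$ with $p$ free variables such that $\bigvee_{i=1}^N\eta_i$ is always true, and such that for every $n\in\mathbb N$ and every $(v_1,\dots,v_p)\in A_n^p$, the $\varpi$-equivalence class of $(v_1,\dots,v_p)$ in $A_n^p$ has cardinality exactly $Q_i(n)$ whenever $\mathbf A_n\models\eta_i(v_1,\dots,v_p)$. Then $(I(\mathbf A_n))_{n\in\mathbb N}$ is a strongly polynomial sequence of $\lambda$-structures.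
   Context: A signature is a finite set of relation symbols with arities; a $\lambda$-structure has a finite domain and, for each symbol of arity $r$, an $r$-ary relation on the domain. For a first-order formula $\phi$ (with equality) with exactly $p$ free variables, $\phi(\mathbf A)$ is the set of $p$-tuples satisfying $\phi$ in $\mathbf A$; a sequence $(\mathbf A_n)_{n\in\mathbb N}$ is strongly polynomial if for every quantifier-free $\phi$ there is a polynomial $P_\phi$ with $|\phi(\mathbf A_n)|=P_\phi(n)$ for all $n\in\mathbb N$. General interpretation scheme: let $\lambda$ have relation symbols $R_1,\dots,R_q$ of arities $r_1,\dots,r_q$. A general interpretation scheme of $\lambda$-structures in $\kappa$-structures is a tuple $I=(p,\varpi,\rho_0,\dots,\rho_q)$ where $\rho_0$ is a $\kappa$-formula with $p$ free variables, $\rho_i$ a $\kappa$-formula with $pr_i$ free variables, and $\varpi$ a $\kappa$-formula with $2p$ free variables defining an equivalence relation on $p$-tuples which is compatible with the $\rho_i$, in the sense that $\bigwedge_{j=1}^{r_i}\varpi(\mathbf x_j,\mathbf y_j)$ entails $\rho_i(\mathbf x_1,\dots,\mathbf x_{r_i})\leftrightarrow\rho_i(\mathbf y_1,\dots,\mathbf y_{r_i})$ (with $r_0=1$). For a $\kappa$-structure $\mathbf A$, $I(\mathbf A)$ is the $\lambda$-structure whose domain is the set of $\varpi$-equivalence classes $[\mathbf x]$ of $p$-tuples $\mathbf x\in A^p$ with $\mathbf A\models\rho_0(\mathbf x)$, and in which $R_i([\mathbf x_1],\dots,[\mathbf x_{r_i}])$ holds iff $\mathbf A\models\rho_i(\mathbf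 x_1,\dots,\mathbf x_{r_i})$. *)

theory Defs
  imports Complex_Main "HOL-Computational_Algebra.Polynomial"
begin

record 'r signature =
  syms :: "'r set"
  arity :: "'r \<Rightarrow> nat"

definition is_signature :: "'r signature \<Rightarrow> bool" where
  "is_signature \<kappa> \<longleftrightarrow> finite (syms \<kappa>)"

record ('r, 'a) rel_struct =
  dom :: "'a set"
  rel :: "'r \<Rightarrow> 'a list set"

hide_const (open) Map.dom

definition tuples :: "nat \<Rightarrow> 'a set \<Rightarrow> 'a list set" where
  "tuples p X = {xs. length xs = p \<and> set xs \<subseteq> X}"

text \<open>Structures are finite; the empty domain is allowed.\<close>

definition is_struct :: "'r signature \<Rightarrow> ('r, 'a) rel_struct \<Rightarrow> bool" where
  "is_struct \<kappa> A \<longleftrightarrow>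
     finite (dom A) \<and> (\<forall>r \<in> syms \<kappa>. rel A r \<subseteq> tuples (arity \<kappa> r) (dom A))"

text \<open>First-order formulas with equality; variables are natural numbers.\<close>

datatype 'r fm =
    FF
  | Eq nat nat
  | Rel 'r "nat list"
  | Neg "'r fm"
  | And "'r fm" "'r fm"
  | Or "'r fm" "'r fm"
  | Ex nat "'r fm"
  | All nat "'r fm"

primrec wf_fm :: "'r signature \<Rightarrow> 'r fm \<Rightarrow> bool" where
  "wf_fm \<kappa> FF \<longleftrightarrow> True"
| "wf_fm \<kappa> (Eq i j) \<longleftrightarrow> True"
| "wf_fm \<kappa> (Rel r is) \<longleftrightarrow> r \<in> syms \<kappa> \<and> length is = arity \<kappa> r"
| "wf_fm \<kappa> (Neg \<phi>) \<longleftrightarrow> wf_fm \<kappa> \<phi>"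
| "wf_fm \<kappa> (And \<phi> \<psi>) \<longleftrightarrow> wf_fm \<kappa> \<phi> \<and> wf_fm \<kappa> \<psi>"
| "wf_fm \<kappa> (Or \<phi> \<psi>) \<longleftrightarrow> wf_fm \<kappa> \<phi> \<and> wf_fm \<kappa> \<psi>"
| "wf_fm \<kappa> (Ex i \<phi>) \<longleftrightarrow> wf_fm \<kappa> \<phi>"
| "wf_fm \<kappa> (All i \<phi>) \<longleftrightarrow> wf_fm \<kappa> \<phi>"

primrec fv :: "'r fm \<Rightarrow> nat set" where
  "fv FF = {}"
| "fv (Eq i j) = {i, j}"
| "fv (Rel r is) = set is"
| "fv (Neg \<phi>) = fv \<phi>"
| "fv (And \<phi> \<psi>) = fv \<phi> \<union> fv \<psi>"
| "fv (Or \<phi> \<psi>) = fv \<phi> \<union> fv \<psi>"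
| "fv (Ex i \<phi>) = fv \<phi> - {i}"
| "fv (All i \<phi>) = fv \<phi> - {i}"

primrec quantifier_free :: "'r fm \<Rightarrow> bool" where
  "quantifier_free FF \<longleftrightarrow> True"
| "quantifier_free (Eq i j) \<longleftrightarrow> True"
| "quantifier_free (Rel r is) \<longleftrightarrow> True"
| "quantifier_free (Neg \<phi>) \<longleftrightarrow> quantifier_free \<phi>"
| "quantifier_free (And \<phi> \<psi>) \<longleftrightarrow> quantifier_free \<phi> \<and> quantifier_free \<psi>"
| "quantifier_free (Or \<phi> \<psi>) \<longleftrightarrow> quantifier_free \<phi> \<and> quantifier_free \<psi>"
| "quantifier_free (Ex i \<phi>) \<longleftrightarrow> False"
| "quantifier_free (All i \<phi>) \<longleftrightarrow> False"

primrec sat :: "('r, 'a) rel_struct \<Rightarrow> (nat \<Rightarrow> 'a) \<Rightarrow> 'r fm \<Rightarrow> bool" where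
  "sat A e FF \<longleftrightarrow> False"
| "sat A e (Eq i j) \<longleftrightarrow> e i = e j"
| "sat A e (Rel r is) \<longleftrightarrow> map e is \<in> rel A r"
| "sat A e (Neg \<phi>) \<longleftrightarrow> \<not> sat A e \<phi>"
| "sat A e (And \<phi> \<psi>) \<longleftrightarrow> sat A e \<phi> \<and> sat A e \<psi>"
| "sat A e (Or \<phi> \<psi>) \<longleftrightarrow> sat A e \<phi> \<or> sat A e \<psi>"
| "sat A e (Ex i \<phi>) \<longleftrightarrow> (\<exists>a \<in> dom A. sat A (e(i := a)) \<phi>)"
| "sat A e (All i \<phi>) \<longleftrightarrow> (\<forall>a \<in> dom A. sat A (e(i := a)) \<phi>)"

definition big_or :: "'r fm list \<Rightarrow> 'r fm" where
  "big_or \<phi>s = foldr Or \<phi>s FF"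

text \<open>A formula with exactly \<open>p\<close> free variables; these are taken to be the variables
  \<open>0, \<dots>, p - 1\<close>, so that a \<open>p\<close>-tuple, given as a list, is itself the assignment.\<close>

definition formula :: "'r signature \<Rightarrow> nat \<Rightarrow> 'r fm \<Rightarrow> bool" where
  "formula \<kappa> p \<phi> \<longleftrightarrow> wf_fm \<kappa> \<phi> \<and> fv \<phi> = {..<p}"

definition models :: "('r, 'a) rel_struct \<Rightarrow> 'r fm \<Rightarrow> 'a list \<Rightarrow> bool" where
  "models A \<phi> xs \<longleftrightarrow> sat A (\<lambda>i. xs ! i) \<phi>"

definition solutions :: "('r, 'a) rel_struct \<Rightarrow> nat \<Rightarrow> 'r fm \<Rightarrow> 'a list set" where
  "solutions A p \<phi> = {xs \<in> tuples p (dom A). models A \<phi> xs}"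

text \<open>The natural numbers that index sequences, and those allowed as values of the
  polynomials \<open>Q\<^sub>i\<close> giving class sizes, are the positive integers; \<open>A 0\<close> is never inspected.
  Positivity of \<open>Q\<^sub>i\<close> cannot be dropped: take for \<open>A\<^sub>n\<close> the bare set with \<open>n - 1\<close> elements,
  all of them equivalent, and \<open>Q\<^sub>1(n) = n - 1\<close>. The quotient is empty for \<open>n = 1\<close> and has
  one element for \<open>n \<ge> 2\<close>.\<close>

definition strongly_polynomial ::
    "'r signature \<Rightarrow> (nat \<Rightarrow> ('r, 'a) rel_struct) \<Rightarrow> bool" where
  "strongly_polynomial \<kappa> A \<longleftrightarrow>
     (\<forall>n\<ge>1. is_struct \<kappa> (A n)) \<and>
     (\<forall>p \<phi>. formula \<kappa> p \<phi> \<longrightarrow> quantifier_free \<phi> \<longrightarrow>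
        (\<exists>P :: real poly. \<forall>n\<ge>1. real (card (solutions (A n) p \<phi>)) = poly P (real n)))"

text \<open>The formulas \<open>\<rho>\<^sub>1, \<dots>, \<rho>\<^sub>q\<close> are indexed by the relation symbols they define.\<close>

record ('s, 'r) scheme =
  expo :: nat
  varpi :: "'r fm"
  rho0 :: "'r fm"
  rho :: "'s \<Rightarrow> 'r fm"

text \<open>In the next three definitions the bound structure \<open>B\<close> has domain type \<open>nat\<close>; since
  structures are finite and formulas are isomorphism invariant, this amounts to quantifying
  over all \<open>\<kappa>\<close>-structures.\<close>

definition valid :: "'r signature \<Rightarrow> nat \<Rightarrow> 'r fm \<Rightarrow> bool" where
  "valid \<kappa> p \<phi> \<longleftrightarrow>
     (\<forall>B :: ('r, nat) rel_struct. is_struct \<kappa> B \<longrightarrow> (\<forall>xs \<in> tuples p (dom B). models B \<phi> xs))"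

definition defines_equiv :: "'r signature \<Rightarrow> nat \<Rightarrow> 'r fm \<Rightarrow> bool" where
  "defines_equiv \<kappa> p \<epsilon> \<longleftrightarrow>
     (\<forall>B :: ('r, nat) rel_struct. is_struct \<kappa> B \<longrightarrow>
        equiv (tuples p (dom B))
          {(x, y). x \<in> tuples p (dom B) \<and> y \<in> tuples p (dom B) \<and> models B \<epsilon> (x @ y)})"

text \<open>Here \<open>xs\<close> and \<open>ys\<close> are lists of \<open>r\<close> tuples of length \<open>p\<close> each, and
  \<open>concat xs\<close> is the resulting tuple of length \<open>p * r\<close>.\<close>

definition compatible :: "'r signature \<Rightarrow> nat \<Rightarrow> 'r fm \<Rightarrow> nat \<Rightarrow> 'r fm \<Rightarrow> bool" where
  "compatible \<kappa> p \<epsilon> r \<phi> \<longleftrightarrow>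
     (\<forall>B :: ('r, nat) rel_struct. is_struct \<kappa> B \<longrightarrow>
        (\<forall>xs \<in> tuples r (tuples p (dom B)). \<forall>ys \<in> tuples r (tuples p (dom B)).
           (\<forall>j<r. models B \<epsilon> (xs ! j @ ys ! j)) \<longrightarrow>
           (models B \<phi> (concat xs) \<longleftrightarrow> models B \<phi> (concat ys))))"

definition interpretation_scheme ::
    "'s signature \<Rightarrow> 'r signature \<Rightarrow> ('s, 'r) scheme \<Rightarrow> bool" where
  "interpretation_scheme \<Lambda> \<kappa> I \<longleftrightarrow>
     formula \<kappa> (2 * expo I) (varpi I) \<and>
     formula \<kappa> (expo I) (rho0 I) \<and>
     (\<forall>s \<in> syms \<Lambda>. formula \<kappa> (expo I * arity \<Lambda> s) (rho I s)) \<and>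
     defines_equiv \<kappa> (expo I) (varpi I) \<and>
     compatible \<kappa> (expo I) (varpi I) 1 (rho0 I) \<and>
     (\<forall>s \<in> syms \<Lambda>. compatible \<kappa> (expo I) (varpi I) (arity \<Lambda> s) (rho I s))"

definition quantifier_free_scheme :: "'s signature \<Rightarrow> ('s, 'r) scheme \<Rightarrow> bool" where
  "quantifier_free_scheme \<Lambda> I \<longleftrightarrow>
     quantifier_free (varpi I) \<and> quantifier_free (rho0 I) \<and>
     (\<forall>s \<in> syms \<Lambda>. quantifier_free (rho I s))"

definition eq_class :: "('s, 'r) scheme \<Rightarrow> ('r, 'a) rel_struct \<Rightarrow> 'a list \<Rightarrow> 'a list set" where
  "eq_class I A x = {y \<in> tuples (expo I) (dom A). models A (varpi I) (x @ y)}"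

definition interp ::
    "'s signature \<Rightarrow> ('s, 'r) scheme \<Rightarrow> ('r, 'a) rel_struct \<Rightarrow> ('s, 'a list set) rel_struct" where
  "interp \<Lambda> I A =
     \<lparr> dom = eq_class I A ` solutions A (expo I) (rho0 I),
       rel = (\<lambda>s. {map (eq_class I A) xs | xs.
                xs \<in> tuples (arity \<Lambda> s) (solutions A (expo I) (rho0 I)) \<and>
                models A (rho I s) (concat xs)}) \<rparr>"

end

theory Submission imports Defs begin

text \<open>A quantifier-free formula \<open>\<phi>\<close> about \<open>I(A)\<close> translates into one about \<open>A\<close>, whose solutions are
  all representatives of the solutions of \<open>\<phi>\<close>. Counting each tuple of representatives with the
  inverse of the product of its class sizes gives \<open>|\<phi>(I(A\<^sub>n))|\<close>. Splitting these tuples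
  according to the first \<open>\<eta>\<^sub>i\<close> that each entry satisfies, the count becomes a finite sum of
  quotients \<open>P(n) / R(n)\<close>, each \<open>R\<close> being a product of some of the \<open>Q\<^sub>i\<close>. So it is a rational
  function of \<open>n\<close> with integer values, hence a polynomial.\<close>

subsection \<open>Integer-valued rational functions\<close>

text \<open>Telescoping \<open>(i + 1)^(k+1) - i^(k+1)\<close> over \<open>i < n\<close> gives
  \<open>n^(k+1)\<close>, while the binomial expansion writes it through the power sums of exponent
  at most \<open>k\<close>. Solving for the sum of exponent \<open>k\<close> gives \<open>U\<close>;
  the lower sums are polynomials by induction.\<close>

lemma sum_power_poly: "\<exists>T :: real poly. \<forall>n. (\<Sum>i<n. real i ^ k) = poly T (real n)"
proof (induction k rule: less_induct)
  case (less k)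
  then obtain T :: "nat \<Rightarrow> real poly"
    where T: "\<And>j n. j < k \<Longrightarrow> (\<Sum>i<n. real i ^ j) = poly (T j) (real n)"
    by metis
  define U where "U = smult (1 / real (Suc k))
     (monom 1 (Suc k) - (\<Sum>j<k. smult (real (Suc k choose j)) (T j)))"
  have "(\<Sum>i<n. real i ^ k) = poly U (real n)" for n
  proof -
    have binom: "real (Suc i) ^ Suc k - real i ^ Suc k
        = (\<Sum>j<k. real (Suc k choose j) * real i ^ j) + real (Suc k) * real i ^ k" for i
    proof -
      have "real (Suc i) ^ Suc k = (\<Sum>j\<le>Suc k. real (Suc k choose j) * real i ^ j)"
        using binomial_ring[of "real i" 1 "Suc k"] by (simp add: add.commute)
      then show ?thesis
        by (simp add: lessThan_Suc_atMost[symmetric])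
    qed
    have "real n ^ Suc k = (\<Sum>i<n. real (Suc i) ^ Suc k - real i ^ Suc k)"
      using sum_lessThan_telescope[of "\<lambda>i. real i ^ Suc k" n] by simp
    also have "\<dots> = (\<Sum>i<n. \<Sum>j<k. real (Suc k choose j) * real i ^ j) + real (Suc k) * (\<Sum>i<n. real i ^ k)"
      by (simp only: binom sum.distrib sum_distrib_left)
    also have "(\<Sum>i<n. \<Sum>j<k. real (Suc k choose j) * real i ^ j)
       = (\<Sum>j<k. real (Suc k choose j) * (\<Sum>i<n. real i ^ j))"
      by (subst sum.swap) (simp add: sum_distrib_left)
    also have "\<dots> = (\<Sum>j<k. real (Suc k choose j) * poly (T j) (real n))"
      using T by simp
    finally show ?thesis
      unfolding U_def by (simp add: poly_sum poly_monom field_simps del: of_nat_Suc)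
  qed
  then show ?case by blast
qed

text \<open>Discrete integration, by linearity from the power sums: it recovers a sequence from its
  forward differences.\<close>

lemma sum_poly_poly:
  fixes S :: "real poly"
  shows "\<exists>T :: real poly. \<forall>n. (\<Sum>i<n. poly S (real i)) = poly T (real n)"
proof -
  obtain T :: "nat \<Rightarrow> real poly" where T: "\<And>k n. (\<Sum>i<n. real i ^ k) = poly (T k) (real n)"
    using sum_power_poly by metis
  have "(\<Sum>i<n. poly S (real i)) = poly (\<Sum>k\<le>degree S. smult (coeff S k) (T k)) (real n)" for n
  proof -
    have "(\<Sum>i<n. poly S (real i)) = (\<Sum>i<n. \<Sum>k\<le>degree S. coeff S k * real i ^ k)"
      by (simp add: poly_altdef)
    also have "\<dots> = (\<Sum>k\<le>degree S. coeff S k * (\<Sum>i<n. real i ^ k))"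
      by (subst sum.swap) (simp add: sum_distrib_left)
    finally show ?thesis
      by (simp add: T poly_sum)
  qed
  then show ?thesis by blast
qed

text \<open>The shifted polynomial \<open>D(x + 1)\<close> has the degree and leading coefficient of
  \<open>D\<close>, so the leading terms cancel.\<close>

lemma degree_poly_shift_diff:
  fixes D :: "real poly"
  assumes "degree D > 0"
  shows "degree (pcompose D [:1, 1:] - D) < degree D"
proof -
  have deg: "degree (pcompose D [:1, 1:]) = degree D"
    by (simp add: degree_pcompose)
  have "lead_coeff (pcompose D [:1, 1:]) = lead_coeff D"
    using lead_coeff_comp[of "[:1, 1 :: real:]" D] by simp
  then have "coeff (pcompose D [:1, 1:] - D) (degree D) = 0"
    using deg by simp
  moreover have "degree (pcompose D [:1, 1:] - D) \<le> degree D"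
    using degree_diff_le[of "pcompose D [:1, 1:]" "degree D" D] deg by simp
  \<comment> \<open>If the degree did not drop, the vanishing coefficient would be the leading one;
    the difference would then be zero, of degree 0, against \<open>degree D > 0\<close>.\<close>
  ultimately show ?thesis
    using assms by (metis degree_0 le_neq_implies_less leading_coeff_0_iff)
qed

text \<open>Induction on the degree: forward differences lower it, and in degree 0 an integer sequence
  that converges is eventually constant.\<close>

lemma integer_seq_near_poly:
  fixes f :: "nat \<Rightarrow> real" and D :: "real poly"
  assumes "\<forall>\<^sub>F n in sequentially. f n \<in> \<int>"
    and "(\<lambda>n. f n - poly D (real n)) \<longlonglongrightarrow> 0"
  shows "\<exists>S :: real poly. \<forall>\<^sub>F n in sequentially. f n = poly S (real n)"
  using assms
proof (induction "degree D" arbitrary: D f rule: less_induct)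
  case less
  show ?case
  proof (cases "degree D = 0")
    case True
    then obtain c where D: "D = [:c:]"
      by (rule degree_eq_zeroE)
    have "\<forall>\<^sub>F n in sequentially. \<bar>f n - c\<bar> < 1 / 2"
      using tendstoD[OF less.prems(2), of "1 / 2"] by (simp add: D dist_real_def)
    with less.prems(1) have "\<forall>\<^sub>F n in sequentially. f n \<in> \<int> \<and> \<bar>f n - c\<bar> < 1 / 2"
      by eventually_elim simp
    then obtain m where m: "\<And>n. n \<ge> m \<Longrightarrow> f n \<in> \<int> \<and> \<bar>f n - c\<bar> < 1 / 2"
      by (auto simp: eventually_sequentially)
    define b where "b = f m"
    \<comment> \<open>Two integers within 1/2 of \<open>c\<close> differ by less than 1, hence
      coincide.\<close>
    have "f n = b" if "n \<ge> m" for n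
    proof (rule ccontr)
      assume "f n \<noteq> b"
      then have "\<bar>f n - b\<bar> \<ge> 1"
        using m[OF that] m[of m] b_def by (intro Ints_nonzero_abs_ge1) auto
      then show False
        using m[OF that] m[of m] b_def by linarith
    qed
    then have "\<forall>\<^sub>F n in sequentially. f n = poly [:b:] (real n)"
      by (intro eventually_sequentiallyI[of m]) simp
    then show ?thesis ..
  next
    case False
    let ?E = "pcompose D [:1, 1:] - D" and ?g = "\<lambda>n. f (Suc n) - f n"
    have "\<forall>\<^sub>F n in sequentially. f (Suc n) \<in> \<int>"
      using less.prems(1) by (rule eventually_sequentially_Suc[THEN iffD2])
    with less.prems(1) have "\<forall>\<^sub>F n in sequentially. ?g n \<in> \<int>"
      by eventually_elim simp
    moreover have "(\<lambda>n. (f (Suc n) - poly D (real (Suc n))) - (f n - poly D (real n))) \<longlonglongrightarrow> 0 - 0"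
      by (intro tendsto_diff less.prems(2) LIMSEQ_Suc[OF less.prems(2)])
    then have "(\<lambda>n. ?g n - poly ?E (real n)) \<longlonglongrightarrow> 0"
      by (simp add: poly_pcompose algebra_simps)
    ultimately obtain S where "\<forall>\<^sub>F n in sequentially. ?g n = poly S (real n)"
      using less.hyps[of ?E ?g] degree_poly_shift_diff[of D] False by auto
    then obtain m where m: "\<And>n. n \<ge> m \<Longrightarrow> ?g n = poly S (real n)"
      by (auto simp: eventually_sequentially)
    obtain T :: "real poly" where T: "\<And>n. (\<Sum>i<n. poly S (real i)) = poly T (real n)"
      using sum_poly_poly by metis
    \<comment> \<open>The added constant makes both sides agree at \<open>m\<close>; from there on
      both grow by \<open>poly S (real n)\<close> at each step.\<close>
    have "f n = poly (T + [:f m - poly T (real m):]) (real n)" if "n \<ge> m" for n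
      using that
    proof (induction n rule: dec_induct)
      case (step n)
      moreover have "poly T (real (Suc n)) = poly T (real n) + poly S (real n)"
        using T[of n] T[of "Suc n"] by simp
      ultimately show ?case
        using m[of n] by simp
    qed simp
    then show ?thesis
      by (intro exI eventually_sequentiallyI)
  qed
qed

text \<open>By polynomial division, a rational function is a polynomial plus a term that tends to 0.\<close>

lemma integer_valued_ratfun_is_poly:
  fixes f :: "nat \<Rightarrow> real" and P Q :: "real poly"
  assumes f: "\<And>n. n \<ge> 1 \<Longrightarrow> f n = poly P (real n) / poly Q (real n)"
    and Q: "\<And>n. n \<ge> 1 \<Longrightarrow> poly Q (real n) \<noteq> 0"
    and int: "\<And>n. n \<ge> 1 \<Longrightarrow> f n \<in> \<int>"
  shows "\<exists>S :: real poly. \<forall>n\<ge>1. f n = poly S (real n)"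
proof -
  have "Q \<noteq> 0"
    using Q[of 1] by auto
  have "(\<lambda>n. poly (P mod Q) (real n) / poly Q (real n)) \<longlonglongrightarrow> 0"
  proof (cases "P mod Q = 0")
    case False
    then have "degree (P mod Q) < degree Q"
      using degree_mod_less[OF \<open>Q \<noteq> 0\<close>, of P] by auto
    then have "((\<lambda>x. poly (P mod Q) x / poly Q x) \<longlongrightarrow> 0) at_infinity"
      by (rule poly_divide_tendsto_0_at_infinity)
    moreover have "filterlim (\<lambda>n. real n) at_infinity sequentially"
      using tendsto_of_nat by blast
    ultimately show ?thesis
      by (rule filterlim_compose)
  qed simp
  moreover have "\<forall>\<^sub>F n in sequentially.
      poly (P mod Q) (real n) / poly Q (real n) = f n - poly (P div Q) (real n)"
    using eventually_ge_at_top[of 1]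
  proof eventually_elim
    case (elim n)
    have "poly P (real n) = poly (P div Q) (real n) * poly Q (real n) + poly (P mod Q) (real n)"
      by (metis div_mult_mod_eq poly_add poly_mult)
    then show ?case
      using f[OF elim] Q[OF elim] by (simp add: field_simps)
  qed
  ultimately have "(\<lambda>n. f n - poly (P div Q) (real n)) \<longlonglongrightarrow> 0"
    by (rule Lim_transform_eventually)
  moreover have "\<forall>\<^sub>F n in sequentially. f n \<in> \<int>"
    using int by (auto simp: eventually_sequentially)
  ultimately obtain S where "\<forall>\<^sub>F n in sequentially. f n = poly S (real n)"
    using integer_seq_near_poly by blast
  then obtain m where m: "\<And>n. n \<ge> m \<Longrightarrow> f n = poly S (real n)"
    by (auto simp: eventually_sequentially)
  \<comment> \<open>So far \<open>f\<close> is known to agree with \<open>S\<close> only from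
    \<open>m\<close> on. A polynomial with infinitely many roots is zero, and the resulting identity
    carries the agreement down to \<open>n = 1\<close>.\<close>
  have "P = S * Q"
  proof (rule ccontr)
    assume "P \<noteq> S * Q"
    then have "finite {x. poly (P - S * Q) x = 0}"
      by (intro poly_roots_finite) simp
    moreover have "real ` {max 1 m..} \<subseteq> {x. poly (P - S * Q) x = 0}"
      using m f Q by (fastforce simp: field_simps)
    ultimately have "finite (real ` {max 1 m..})"
      by (rule rev_finite_subset)
    then show False
      by (simp add: finite_image_iff infinite_Ici inj_on_of_nat)
  qed
  then show ?thesis
    using f Q by auto
qed

text \<open>Common denominators. That the denominator has no zero at any \<open>n \<ge> 1\<close> is
  kept in the conclusion for \<open>integer_valued_ratfun_is_poly\<close>.\<close>

lemma ratfun_sum: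
  fixes P Q :: "'b \<Rightarrow> real poly"
  assumes "finite V" and "\<And>v n. \<lbrakk>v \<in> V; n \<ge> 1\<rbrakk> \<Longrightarrow> poly (Q v) (real n) \<noteq> 0"
  shows "\<exists>R S :: real poly. \<forall>n\<ge>1. poly S (real n) \<noteq> 0 \<and>
    (\<Sum>v\<in>V. poly (P v) (real n) / poly (Q v) (real n)) = poly R (real n) / poly S (real n)"
  using assms
proof (induction V rule: finite_induct)
  case empty
  show ?case
    by (intro exI[of _ 0] exI[of _ 1]) simp
next
  case (insert v V)
  then obtain R S :: "real poly" where "\<forall>n\<ge>1. poly S (real n) \<noteq> 0 \<and>
      (\<Sum>v\<in>V. poly (P v) (real n) / poly (Q v) (real n)) = poly R (real n) / poly S (real n)"
    by (metis insertCI)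
  then show ?case
    using insert
    by (intro exI[of _ "P v * S + R * Q v"] exI[of _ "Q v * S"]) (simp add: add_frac_eq)
qed

subsection \<open>Quantifier-free formulas\<close>

lemma sat_cong:
  assumes "quantifier_free \<phi>" and "\<And>i. i \<in> fv \<phi> \<Longrightarrow> e i = e' i"
  shows "sat A e \<phi> \<longleftrightarrow> sat A e' \<phi>"
  using assms
proof (induction \<phi>)
  case (Rel r "is")
  then have "map e is = map e' is" by simp
  then show ?case by (simp only: sat.simps)
qed auto

text \<open>Meant for quantifier-free formulas, where no variable can be captured. The dummy value
  \<open>FF\<close> at quantifiers makes every result quantifier-free without a side
  condition.\<close>

primrec rename :: "(nat \<Rightarrow> nat) \<Rightarrow> 'r fm \<Rightarrow> 'r fm" where
  "rename \<sigma> FF = FF"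
| "rename \<sigma> (Eq i j) = Eq (\<sigma> i) (\<sigma> j)"
| "rename \<sigma> (Rel r is) = Rel r (map \<sigma> is)"
| "rename \<sigma> (Neg \<phi>) = Neg (rename \<sigma> \<phi>)"
| "rename \<sigma> (And \<phi> \<psi>) = And (rename \<sigma> \<phi>) (rename \<sigma> \<psi>)"
| "rename \<sigma> (Or \<phi> \<psi>) = Or (rename \<sigma> \<phi>) (rename \<sigma> \<psi>)"
| "rename \<sigma> (Ex i \<phi>) = FF"
| "rename \<sigma> (All i \<phi>) = FF"

lemma quantifier_free_rename [simp]: "quantifier_free (rename \<sigma> \<phi>)"
  by (induction \<phi>) auto

lemma wf_fm_rename: "wf_fm \<kappa> \<phi> \<Longrightarrow> wf_fm \<kappa> (rename \<sigma> \<phi>)"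
  by (induction \<phi>) auto

lemma fv_rename: "quantifier_free \<phi> \<Longrightarrow> fv (rename \<sigma> \<phi>) = \<sigma> ` fv \<phi>"
  by (induction \<phi>) auto

lemma sat_rename: "quantifier_free \<phi> \<Longrightarrow> sat A e (rename \<sigma> \<phi>) \<longleftrightarrow> sat A (e \<circ> \<sigma>) \<phi>"
  by (induction \<phi>) auto

definition big_and :: "'r fm list \<Rightarrow> 'r fm" where
  "big_and \<phi>s = foldr And \<phi>s (Neg FF)"

lemma sat_big_and [simp]: "sat A e (big_and \<phi>s) \<longleftrightarrow> (\<forall>\<phi>\<in>set \<phi>s. sat A e \<phi>)"
  and wf_fm_big_and [simp]: "wf_fm \<kappa> (big_and \<phi>s) \<longleftrightarrow> (\<forall>\<phi>\<in>set \<phi>s. wf_fm \<kappa> \<phi>)"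
  and quantifier_free_big_and [simp]:
    "quantifier_free (big_and \<phi>s) \<longleftrightarrow> (\<forall>\<phi>\<in>set \<phi>s. quantifier_free \<phi>)"
  and fv_big_and [simp]: "fv (big_and \<phi>s) = (\<Union>\<phi>\<in>set \<phi>s. fv \<phi>)"
  unfolding big_and_def by (induction \<phi>s) auto

lemma sat_big_or [simp]: "sat A e (big_or \<phi>s) \<longleftrightarrow> (\<exists>\<phi>\<in>set \<phi>s. sat A e \<phi>)"
  and wf_fm_big_or [simp]: "wf_fm \<kappa> (big_or \<phi>s) \<longleftrightarrow> (\<forall>\<phi>\<in>set \<phi>s. wf_fm \<kappa> \<phi>)"
  and quantifier_free_big_or [simp]:
    "quantifier_free (big_or \<phi>s) \<longleftrightarrow> (\<forall>\<phi>\<in>set \<phi>s. quantifier_free \<phi>)"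
  and fv_big_or [simp]: "fv (big_or \<phi>s) = (\<Union>\<phi>\<in>set \<phi>s. fv \<phi>)"
  unfolding big_or_def by (induction \<phi>s) auto

lemma tuples_iff: "xs \<in> tuples p X \<longleftrightarrow> length xs = p \<and> (\<forall>i<p. xs ! i \<in> X)"
  by (auto simp: tuples_def set_conv_nth)

lemma finite_tuples: "finite X \<Longrightarrow> finite (tuples p X)"
  using finite_lists_length_eq[of X p] by (simp add: tuples_def conj_commute)

text \<open>\<^const>\<open>strongly_polynomial\<close> only speaks about formulas whose free variables are exactly
  \<open>{..<p}\<close>; trivial equations supply the missing ones.\<close>

lemma card_solutions_poly:
  assumes "strongly_polynomial \<kappa> A"
    and "wf_fm \<kappa> \<phi>" "quantifier_free \<phi>" "fv \<phi> \<subseteq> {..<p}"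
  shows "\<exists>P :: real poly. \<forall>n\<ge>1. real (card (solutions (A n) p \<phi>)) = poly P (real n)"
proof -
  define \<psi> where "\<psi> = And \<phi> (big_and (map (\<lambda>i. Eq i i) [0..<p]))"
  have "formula \<kappa> p \<psi>" "quantifier_free \<psi>"
    using assms by (auto simp: \<psi>_def formula_def)
  moreover have "solutions (A n) p \<psi> = solutions (A n) p \<phi>" for n
    by (auto simp: \<psi>_def solutions_def models_def)
  ultimately show ?thesis
    using assms(1) unfolding strongly_polynomial_def by metis
qed

section \<open>Transfer to isomorphic copies with domain in \<open>nat\<close>\<close>

text \<open>\<open>valid\<close>, \<open>defines_equiv\<close> and \<open>compatible\<close>
  quantify over structures on \<open>nat\<close> only. A finite domain injects into
  \<open>nat\<close>, and transporting the relations along the injection preserves all atoms; this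
  makes those hypotheses available for the structures \<open>A n\<close>.\<close>

lemma ex_nat_copy:
  fixes A :: "('r, 'a) rel_struct"
  assumes "is_struct \<kappa> A"
  obtains B :: "('r, nat) rel_struct" and f :: "'a \<Rightarrow> nat"
  where "is_struct \<kappa> B" "inj_on f (dom A)" "dom B = f ` dom A"
    "\<And>\<phi> p xs. \<lbrakk>formula \<kappa> p \<phi>; quantifier_free \<phi>; xs \<in> tuples p (dom A)\<rbrakk>
       \<Longrightarrow> models B \<phi> (map f xs) \<longleftrightarrow> models A \<phi> xs"
proof -
  from assms have fin: "finite (dom A)"
    by (simp add: is_struct_def)
  then obtain f :: "'a \<Rightarrow> nat" where inj: "inj_on f (dom A)"
    using finite_imp_inj_to_nat_seg by blast
  define B :: "('r, nat) rel_struct" where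
    "B = \<lparr>dom = f ` dom A, rel = (\<lambda>r. map f ` rel A r)\<rparr>"
  have "is_struct \<kappa> B"
    using assms unfolding is_struct_def B_def tuples_def by fastforce
  moreover have "models B \<phi> (map f xs) \<longleftrightarrow> models A \<phi> xs"
    if "formula \<kappa> p \<phi>" "quantifier_free \<phi>" "xs \<in> tuples p (dom A)" for \<phi> p xs
  proof -
    have "wf_fm \<kappa> \<phi>" "fv \<phi> \<subseteq> {..<p}"
      using that by (auto simp: formula_def)
    with that(2) show ?thesis
      unfolding models_def
    proof (induction \<phi>)
      case (Eq i j)
      then show ?case
        using that(3) inj by (auto simp: tuples_iff inj_on_def)
    next
      case (Rel r "is")
      let ?ys = "map ((!) xs) is"
      have eq: "map ((!) (map f xs)) is = map f ?ys"
        using Rel.prems that(3) by (auto simp: tuples_iff)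
      \<comment> \<open>Injectivity holds only on lists over \<open>dom A\<close>. The instance
        \<open>?ys\<close> lies there, and so does all of \<open>rel A r\<close>, since
        \<open>A\<close> is a structure.\<close>
      have injm: "inj_on (map f) {ys. set ys \<subseteq> dom A}"
        by (intro inj_on_mapI inj_on_subset[OF inj]) auto
      have "map f ?ys \<in> map f ` rel A r \<longleftrightarrow> ?ys \<in> rel A r"
      proof (rule inj_on_image_mem_iff[OF injm])
        show "?ys \<in> {ys. set ys \<subseteq> dom A}"
          using Rel.prems that(3) by (auto simp: tuples_iff)
        show "rel A r \<subseteq> {ys. set ys \<subseteq> dom A}"
          using Rel.prems assms by (auto simp: is_struct_def tuples_def)
      qed
      then show ?case
        by (simp only: sat.simps eq) (simp add: B_def)
    qed (auto simp: B_def)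
  qed
  moreover have "dom B = f ` dom A"
    by (simp add: B_def)
  ultimately show ?thesis
    using that inj by blast
qed

lemma valid_models:
  assumes "is_struct \<kappa> A" "valid \<kappa> p \<phi>" "formula \<kappa> p \<phi>" "quantifier_free \<phi>" "xs \<in> tuples p (dom A)"
  shows "models A \<phi> xs"
proof -
  obtain B :: "('a, nat) rel_struct" and f where B: "is_struct \<kappa> B" "dom B = f ` dom A"
    "\<And>\<phi> p xs. \<lbrakk>formula \<kappa> p \<phi>; quantifier_free \<phi>; xs \<in> tuples p (dom A)\<rbrakk>
       \<Longrightarrow> models B \<phi> (map f xs) \<longleftrightarrow> models A \<phi> xs"
    using ex_nat_copy[OF assms(1)] by metis
  have "map f xs \<in> tuples p (dom B)"
    using assms(5) B(2) by (auto simp: tuples_def)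
  then show ?thesis
    using B assms unfolding valid_def by blast
qed

section \<open>Concatenation of tuples of equal length\<close>

lemma append_mem_tuples: "x \<in> tuples p X \<Longrightarrow> y \<in> tuples p X \<Longrightarrow> x @ y \<in> tuples (2 * p) X"
  by (auto simp: tuples_def)

lemma length_concat_uniform: "\<forall>x\<in>set xs. length x = p \<Longrightarrow> length (concat xs) = p * length xs"
  by (induction xs) auto

lemma concat_mem_tuples: "xs \<in> tuples m (tuples p X) \<Longrightarrow> concat xs \<in> tuples (p * m) X"
  using length_concat_uniform[of xs p] by (auto simp: tuples_def)

lemma nth_concat_uniform:
  "\<lbrakk>\<forall>x\<in>set xs. length x = p; j < length xs; k < p\<rbrakk> \<Longrightarrow> concat xs ! (j * p + k) = xs ! j ! k"
proof (induction xs arbitrary: j)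
  case (Cons x xs)
  then show ?case
    by (cases j) (auto simp: nth_append)
qed simp

text \<open>Blocks of fixed length can be read off again, by cutting off the first \<open>p\<close>
  entries \<open>m\<close> times. Tuples of representatives can thus be counted as solutions of one
  formula in \<open>p * m\<close> variables.\<close>

lemma bij_betw_concat: "bij_betw concat (tuples m (tuples p X)) (tuples (p * m) X)"
proof (rule bij_betw_imageI)
  show "inj_on concat (tuples m (tuples p X))"
    by (intro inj_onI concat_injective) (auto simp: tuples_iff set_zip)
  show "concat ` tuples m (tuples p X) = tuples (p * m) X"
  proof (intro equalityI subsetI)
    fix zs assume "zs \<in> tuples (p * m) X"
    then have "zs \<in> concat ` tuples m (tuples p X)"
    proof (induction m arbitrary: zs)
      case (Suc m)
      then have "drop p zs \<in> concat ` tuples m (tuples p X)"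
        by (intro Suc.IH) (auto simp: tuples_def dest: in_set_dropD)
      then obtain xs where "xs \<in> tuples m (tuples p X)" "drop p zs = concat xs"
        by auto
      moreover have "take p zs \<in> tuples p X"
        using Suc.prems by (auto simp: tuples_def dest: in_set_takeD)
      ultimately have "take p zs # xs \<in> tuples (Suc m) (tuples p X)"
        "zs = concat (take p zs # xs)"
        by (auto simp: tuples_def) (metis append_take_drop_id)
      then show ?case by blast
    qed (auto simp: tuples_def image_iff)
    then show "zs \<in> concat ` tuples m (tuples p X)" .
  qed (auto dest: concat_mem_tuples)
qed

text \<open>Induction peels off one factor of a Cartesian product in list form. Applied to a list of
  classes, it counts the tuples of representatives.\<close>

lemma card_list_all2_mem: "card {xs. list_all2 (\<in>) xs Xs} = (\<Prod>X\<leftarrow>Xs. card X)"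
proof (induction Xs)
  case (Cons X Xs)
  have "{xs. list_all2 (\<in>) xs (X # Xs)}
      = (\<lambda>(x, xs). x # xs) ` (X \<times> {xs. list_all2 (\<in>) xs Xs})"
    by (auto simp: list_all2_Cons2)
  moreover have "inj_on (\<lambda>(x, xs). x # xs) (X \<times> {xs. list_all2 (\<in>) xs Xs})"
    by (auto simp: inj_on_def)
  ultimately show ?case
    using Cons by (simp add: card_image card_cartesian_product)
qed simp

lemma of_nat_prod_list: "real (prod_list ns) = (\<Prod>n\<leftarrow>ns. real n)"
  by (induction ns) auto

subsection \<open>Counting in the interpreted structure\<close>

text \<open>The variable \<open>i\<close> over the interpreted structure is represented by the block of variables
  \<open>{i * expo I..<Suc i * expo I}\<close>.\<close>

primrec interp_fm :: "('s, 'r) scheme \<Rightarrow> 's fm \<Rightarrow> 'r fm" where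
  "interp_fm I FF = FF"
| "interp_fm I (Eq i j) =
     rename (\<lambda>k. if k < expo I then i * expo I + k else j * expo I + (k - expo I)) (varpi I)"
| "interp_fm I (Rel s is) = rename (\<lambda>k. is ! (k div expo I) * expo I + k mod expo I) (rho I s)"
| "interp_fm I (Neg \<phi>) = Neg (interp_fm I \<phi>)"
| "interp_fm I (And \<phi> \<psi>) = And (interp_fm I \<phi>) (interp_fm I \<psi>)"
| "interp_fm I (Or \<phi> \<psi>) = Or (interp_fm I \<phi>) (interp_fm I \<psi>)"
| "interp_fm I (Ex i \<phi>) = FF"
| "interp_fm I (All i \<phi>) = FF"

lemma quantifier_free_interp_fm [simp]: "quantifier_free (interp_fm I \<phi>)"
  by (induction \<phi>) auto

lemma block_index_less:
  fixes j k m p :: nat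
  assumes "j < m" "k < p"
  shows "j * p + k < p * m"
proof -
  have "j * p + k < Suc j * p" using assms by simp
  also have "\<dots> \<le> m * p" using assms by (intro mult_le_mono1) simp
  finally show ?thesis by (simp add: mult.commute)
qed

lemma div_mod_less: "k < p * r \<Longrightarrow> k div p < r \<and> k mod p < (p :: nat)"
  by (metis less_mult_imp_div_less mod_less_divisor mult.commute mult_0 not_less_zero neq0_conv)

text \<open>The counting identity concerns a single structure; the theorem instantiates it at each
  \<open>A n\<close> with \<open>n \<ge> 1\<close>.\<close>

locale interpreted_struct =
  fixes \<kappa> :: "'r signature" and \<Lambda> :: "'s signature"
    and A :: "('r, 'a) rel_struct" and I :: "('s, 'r) scheme"
  assumes struct: "is_struct \<kappa> A"
    and scheme: "interpretation_scheme \<Lambda> \<kappa> I"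
    and qf_scheme: "quantifier_free_scheme \<Lambda> I"
begin

abbreviation "D \<equiv> tuples (expo I) (dom A)"
abbreviation "U \<equiv> solutions A (expo I) (rho0 I)"
abbreviation "cls \<equiv> eq_class I A"

lemma varpi_formula: "formula \<kappa> (2 * expo I) (varpi I)" "quantifier_free (varpi I)"
  using scheme qf_scheme by (auto simp: interpretation_scheme_def quantifier_free_scheme_def)

lemma rho0_formula: "formula \<kappa> (expo I) (rho0 I)" "quantifier_free (rho0 I)"
  using scheme qf_scheme by (auto simp: interpretation_scheme_def quantifier_free_scheme_def)

lemma rho_formula:
  assumes "s \<in> syms \<Lambda>"
  shows "formula \<kappa> (expo I * arity \<Lambda> s) (rho I s)" "quantifier_free (rho I s)"
  using scheme qf_scheme assms by (auto simp: interpretation_scheme_def quantifier_free_scheme_def)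

lemma wf_fm_interp_fm: "wf_fm \<Lambda> \<phi> \<Longrightarrow> wf_fm \<kappa> (interp_fm I \<phi>)"
  using varpi_formula rho_formula by (induction \<phi>) (auto simp: formula_def intro!: wf_fm_rename)

lemma fv_interp_fm:
  assumes "wf_fm \<Lambda> \<phi>" "quantifier_free \<phi>" "fv \<phi> \<subseteq> {..<m}"
  shows "fv (interp_fm I \<phi>) \<subseteq> {..<expo I * m}"
  using assms
proof (induction \<phi>)
  case (Eq i j)
  then have ij: "i < m" "j < m"
    by auto
  have "(if k < expo I then i * expo I + k else j * expo I + (k - expo I)) < expo I * m"
    if "k < 2 * expo I" for k
    using that block_index_less[OF ij(1), of k "expo I"] block_index_less[OF ij(2), of "k - expo I" "expo I"]
    by (cases "k < expo I") auto
  moreover have "fv (varpi I) = {..<2 * expo I}"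
    using varpi_formula(1) by (simp add: formula_def)
  ultimately show ?case
    unfolding interp_fm.simps fv_rename[OF varpi_formula(2)] by (intro image_subsetI) blast
next
  case (Rel s "is")
  have "is ! (k div expo I) * expo I + k mod expo I < expo I * m"
    if "k < expo I * arity \<Lambda> s" for k
  proof (rule block_index_less)
    have "is ! (k div expo I) \<in> set is"
      using div_mod_less[OF that] Rel.prems by simp
    then show "is ! (k div expo I) < m"
      using Rel.prems by auto
  qed (use div_mod_less[OF that] in simp)
  then show ?case
    using rho_formula[of s] Rel.prems by (simp add: fv_rename formula_def image_subset_iff)
qed auto

section \<open>The equivalence relation and its compatibility with the formulas of the
  scheme\<close>

lemma finite_D: "finite D"
  using struct by (simp add: is_struct_def finite_tuples)

lemma U_subset_D: "U \<subseteq> D"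
  by (auto simp: solutions_def)

text \<open>\<open>defines_equiv\<close> gives an equivalence on the copy over \<open>nat\<close>;
  its pullback along \<open>map f\<close> is again reflexive, symmetric and transitive.\<close>

lemma varpi_equiv:
  "equiv D {(x, y). x \<in> D \<and> y \<in> D \<and> models A (varpi I) (x @ y)}"
proof -
  obtain B :: "('r, nat) rel_struct" and f where B: "is_struct \<kappa> B" "dom B = f ` dom A"
    "\<And>\<phi> p xs. \<lbrakk>formula \<kappa> p \<phi>; quantifier_free \<phi>; xs \<in> tuples p (dom A)\<rbrakk>
       \<Longrightarrow> models B \<phi> (map f xs) \<longleftrightarrow> models A \<phi> xs"
    using ex_nat_copy[OF struct] by metis
  define E where "E = {(x, y). x \<in> tuples (expo I) (dom B) \<and> y \<in> tuples (expo I) (dom B)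
      \<and> models B (varpi I) (x @ y)}"
  have eqv: "equiv (tuples (expo I) (dom B)) E"
    using scheme B(1) by (simp add: interpretation_scheme_def defines_equiv_def E_def)
  have mem: "map f x \<in> tuples (expo I) (dom B)" if "x \<in> D" for x
    using that B(2) by (auto simp: tuples_def)
  have iff: "models A (varpi I) (x @ y) \<longleftrightarrow> (map f x, map f y) \<in> E" if "x \<in> D" "y \<in> D" for x y
    using B(3)[OF varpi_formula append_mem_tuples[OF that]] mem that by (simp add: E_def)
  show ?thesis
  proof (rule equivI)
    show "refl_on D {(x, y). x \<in> D \<and> y \<in> D \<and> models A (varpi I) (x @ y)}"
      using equiv_class_self[OF eqv] mem iff by (auto simp: refl_on_def)
    show "sym {(x, y). x \<in> D \<and> y \<in> D \<and> models A (varpi I) (x @ y)}"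
      using eqv iff by (auto simp: equiv_def intro!: symI dest: symD)
    show "trans {(x, y). x \<in> D \<and> y \<in> D \<and> models A (varpi I) (x @ y)}"
      using eqv iff by (auto simp: equiv_def intro!: transI dest: transD)
  qed auto
qed

lemma eq_class_eq_iff:
  assumes "x \<in> D" "y \<in> D"
  shows "cls x = cls y \<longleftrightarrow> models A (varpi I) (x @ y)"
proof -
  have "cls z = {(x, y). x \<in> D \<and> y \<in> D \<and> models A (varpi I) (x @ y)} `` {z}" if "z \<in> D" for z
    using that by (auto simp: eq_class_def)
  then show ?thesis
    using eq_equiv_class_iff[OF varpi_equiv assms] assms by simp
qed

lemma mem_eq_class_iff: "x \<in> D \<Longrightarrow> y \<in> cls x \<longleftrightarrow> y \<in> D \<and> cls y = cls x"
  using eq_class_eq_iff[of x y] by (auto simp: eq_class_def)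

text \<open>Both lists of tuples are moved to the copy over \<open>nat\<close>, where
  \<open>compatible\<close> applies, and back. Equality of classes supplies the required instances
  of \<open>varpi\<close>.\<close>

lemma compatible_concat:
  assumes compat: "compatible \<kappa> (expo I) (varpi I) r \<phi>"
    and \<phi>: "formula \<kappa> (expo I * r) \<phi>" "quantifier_free \<phi>"
    and mem: "xs \<in> tuples r D" "ys \<in> tuples r D" and eq: "map cls xs = map cls ys"
  shows "models A \<phi> (concat xs) \<longleftrightarrow> models A \<phi> (concat ys)"
proof -
  obtain B :: "('r, nat) rel_struct" and f where B: "is_struct \<kappa> B" "dom B = f ` dom A"
    "\<And>\<phi> p xs. \<lbrakk>formula \<kappa> p \<phi>; quantifier_free \<phi>; xs \<in> tuples p (dom A)\<rbrakk>
       \<Longrightarrow> models B \<phi> (map f xs) \<longleftrightarrow> models A \<phi> xs"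
    using ex_nat_copy[OF struct] by metis
  have "models B (varpi I) (map (map f) xs ! j @ map (map f) ys ! j)" if "j < r" for j
  proof -
    have "xs ! j \<in> D" "ys ! j \<in> D" "length xs = r" "length ys = r"
      using mem that by (auto simp: tuples_iff)
    moreover from this have "cls (xs ! j) = cls (ys ! j)"
      using eq that by (metis nth_map)
    ultimately show ?thesis
      using B(3)[OF varpi_formula append_mem_tuples[of "xs ! j" _ _ "ys ! j"]] that
      by (simp add: eq_class_eq_iff)
  qed
  moreover have "map (map f) zs \<in> tuples r (tuples (expo I) (dom B))" if "zs \<in> tuples r D" for zs
    using that B(2) by (fastforce simp: tuples_def)
  ultimately have "models B \<phi> (concat (map (map f) xs)) \<longleftrightarrow> models B \<phi> (concat (map (map f) ys))"
    using compat B(1) mem unfolding compatible_def by blast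
  then show ?thesis
    using B(3)[OF \<phi> concat_mem_tuples] mem by (simp flip: map_concat)
qed

text \<open>This is compatibility of \<open>varpi\<close> with \<open>rho0\<close>. A class meeting
  \<open>U\<close> lies inside \<open>U\<close>, so its representatives in \<open>U\<close> are as
  many as the class size prescribed by the \<open>Q i\<close>.\<close>

lemma U_closed:
  assumes "x \<in> U" "y \<in> cls x"
  shows "y \<in> U"
proof -
  have x: "x \<in> D" and y: "y \<in> D" "cls y = cls x"
    using assms mem_eq_class_iff[of x y] U_subset_D by auto
  have "compatible \<kappa> (expo I) (varpi I) 1 (rho0 I)"
    using scheme by (simp add: interpretation_scheme_def)
  \<comment> \<open>One-element lists bring \<open>rho0\<close> under the case of arity 1.\<close>
  then have "models A (rho0 I) (concat [y]) \<longleftrightarrow> models A (rho0 I) (concat [x])"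
    by (rule compatible_concat) (use rho0_formula x y in \<open>auto simp: tuples_def[of "Suc 0"]\<close>)
  then show ?thesis
    using assms(1) y(1) by (simp add: solutions_def)
qed

lemma models_rho_cong:
  assumes "s \<in> syms \<Lambda>" "xs \<in> tuples (arity \<Lambda> s) U" "ys \<in> tuples (arity \<Lambda> s) U"
    "map cls xs = map cls ys"
  shows "models A (rho I s) (concat xs) \<longleftrightarrow> models A (rho I s) (concat ys)"
proof (rule compatible_concat)
  show "compatible \<kappa> (expo I) (varpi I) (arity \<Lambda> s) (rho I s)"
    using scheme assms(1) by (simp add: interpretation_scheme_def)
qed (use assms rho_formula U_subset_D in \<open>auto simp: tuples_def[of "arity \<Lambda> s"]\<close>)

section \<open>Truth of translated formulas\<close>

lemma nth_concat_block:
  assumes "xs \<in> tuples m D" "j < m" "k < expo I"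
  shows "concat xs ! (j * expo I + k) = xs ! j ! k"
  using assms by (intro nth_concat_uniform) (auto simp: tuples_def)

lemma sat_rename_block:
  assumes "quantifier_free \<psi>" "fv \<psi> \<subseteq> {..<expo I}" "xs \<in> tuples m D" "j < m"
  shows "sat A ((!) (concat xs)) (rename (\<lambda>k. j * expo I + k) \<psi>) \<longleftrightarrow> models A \<psi> (xs ! j)"
  unfolding models_def sat_rename[OF assms(1)]
  using assms by (intro sat_cong) (auto simp: nth_concat_block)

lemma dom_interp: "dom (interp \<Lambda> I A) = cls ` U"
  by (simp add: interp_def)

lemma mem_rel_interp:
  "Xs \<in> rel (interp \<Lambda> I A) s \<longleftrightarrow>
     (\<exists>xs\<in>tuples (arity \<Lambda> s) U. Xs = map cls xs \<and> models A (rho I s) (concat xs))"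
  by (auto simp: interp_def)

text \<open>Equality of classes amounts to \<open>varpi\<close> between representatives, and a
  relational atom may be tested on any representatives. The Boolean cases are immediate.\<close>

lemma sat_interp_fm:
  assumes "wf_fm \<Lambda> \<phi>" "quantifier_free \<phi>" "fv \<phi> \<subseteq> {..<m}" "xs \<in> tuples m U"
  shows "sat A ((!) (concat xs)) (interp_fm I \<phi>)
    \<longleftrightarrow> sat (interp \<Lambda> I A) ((!) (map cls xs)) \<phi>"
  using assms(1-3)
proof (induction \<phi>)
  case (Eq i j)
  have xs: "xs \<in> tuples m D"
    using assms(4) U_subset_D by (auto simp: tuples_def[of m])
  have ij: "i < m" "j < m"
    using Eq by auto
  with xs have mem: "xs ! i \<in> D" "xs ! j \<in> D"
    by (auto simp: tuples_iff[of _ m])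
  have "sat A ((!) (concat xs)) (interp_fm I (Eq i j)) \<longleftrightarrow> models A (varpi I) (xs ! i @ xs ! j)"
    unfolding models_def interp_fm.simps sat_rename[OF varpi_formula(2)]
  proof (rule sat_cong[OF varpi_formula(2)])
    let ?\<sigma> = "\<lambda>k. if k < expo I then i * expo I + k else j * expo I + (k - expo I)"
    fix k assume "k \<in> fv (varpi I)"
    then have k: "k < 2 * expo I"
      using varpi_formula(1) by (simp add: formula_def)
    show "((!) (concat xs) \<circ> ?\<sigma>) k = (xs ! i @ xs ! j) ! k"
    proof (cases "k < expo I")
      case True
      then show ?thesis
        using nth_concat_block[OF xs ij(1)] mem by (simp add: nth_append tuples_def)
    next
      case False
      then have "concat xs ! (j * expo I + (k - expo I)) = xs ! j ! (k - expo I)"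
        using k by (intro nth_concat_block[OF xs ij(2)]) simp
      then show ?thesis
        using False mem by (simp add: nth_append tuples_def)
    qed
  qed
  also have "\<dots> \<longleftrightarrow> cls (xs ! i) = cls (xs ! j)"
    by (simp add: eq_class_eq_iff mem)
  finally show ?case
    using ij assms(4) by (simp add: tuples_def)
next
  case (Rel s "is")
  let ?ys = "map ((!) xs) is"
  have s: "s \<in> syms \<Lambda>" "length is = arity \<Lambda> s"
    using Rel by auto
  have xs: "xs \<in> tuples m D"
    using assms(4) U_subset_D by (auto simp: tuples_def[of m])
  have ys: "?ys \<in> tuples (arity \<Lambda> s) U"
    using assms(4) Rel by (auto simp: tuples_iff[of _ m] tuples_def[of "arity \<Lambda> s"])
  then have ysD: "?ys \<in> tuples (arity \<Lambda> s) D"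
    using U_subset_D by (auto simp: tuples_def[of "arity \<Lambda> s"])
  have "sat A ((!) (concat xs)) (interp_fm I (Rel s is)) \<longleftrightarrow> models A (rho I s) (concat ?ys)"
    unfolding models_def interp_fm.simps sat_rename[OF rho_formula(2)[OF s(1)]]
  proof (rule sat_cong[OF rho_formula(2)[OF s(1)]])
    fix k assume "k \<in> fv (rho I s)"
    then have k: "k div expo I < arity \<Lambda> s" "k mod expo I < expo I"
      using rho_formula(1)[OF s(1)] div_mod_less by (auto simp: formula_def)
    then have "is ! (k div expo I) \<in> set is"
      using s(2) by simp
    then have "is ! (k div expo I) < m"
      using Rel.prems(3) by auto
    then show "((!) (concat xs) \<circ> (\<lambda>k. is ! (k div expo I) * expo I + k mod expo I)) k = concat ?ys ! k"
      using nth_concat_block[OF xs, of "is ! (k div expo I)", OF _ k(2)] nth_concat_block[OF ysD k] s(2) k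
      by simp
  qed
  \<comment> \<open>The relation asks for some tuple of representatives satisfying
    \<open>rho I s\<close>; by \<open>models_rho_cong\<close> the tuple \<open>?ys\<close> decides
    it.\<close>
  also have "\<dots> \<longleftrightarrow> map cls ?ys \<in> rel (interp \<Lambda> I A) s"
    unfolding mem_rel_interp using models_rho_cong[OF s(1) ys] ys by blast
  also have "map cls ?ys = map ((!) (map cls xs)) is"
    using Rel.prems(3) assms(4) by (auto simp: tuples_def)
  finally show ?case by simp
qed auto

lemma is_struct_interp: "is_struct \<Lambda> (interp \<Lambda> I A)"
  using finite_subset[OF U_subset_D finite_D]
  by (auto simp: is_struct_def interp_def tuples_def[of "arity \<Lambda> _"] intro!: imageI)

section \<open>Weighted counting of representatives\<close>

lemma eq_class_finite_nonempty:
  assumes "u \<in> U"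
  shows "finite (cls u)" "cls u \<noteq> {}"
proof -
  show "finite (cls u)"
    using finite_D by (rule finite_subset[rotated]) (auto simp: eq_class_def)
  have "u \<in> cls u"
    using assms U_subset_D mem_eq_class_iff[of u u] by blast
  then show "cls u \<noteq> {}" by blast
qed

lemma U_mem_eq_class_iff: "u \<in> U \<Longrightarrow> x \<in> cls u \<longleftrightarrow> x \<in> U \<and> cls x = cls u"
  using U_closed U_subset_D mem_eq_class_iff by blast

lemma list_all2_mem_eq_class:
  assumes "us \<in> tuples m U"
  shows "list_all2 (\<in>) xs (map cls us) \<longleftrightarrow> xs \<in> tuples m U \<and> map cls xs = map cls us"
proof -
  have "list_all2 (\<in>) xs (map cls us) \<longleftrightarrow> length xs = m \<and> (\<forall>i<m. xs ! i \<in> cls (us ! i))"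
    using assms by (auto simp: list_all2_conv_all_nth tuples_def[of m])
  also have "\<dots> \<longleftrightarrow> length xs = m \<and> (\<forall>i<m. xs ! i \<in> U \<and> cls (xs ! i) = cls (us ! i))"
    using assms by (simp add: tuples_iff[of _ m] U_mem_eq_class_iff)
  also have "\<dots> \<longleftrightarrow> xs \<in> tuples m U \<and> map cls xs = map cls us"
    using assms by (auto simp: tuples_iff[of _ m] list_eq_iff_nth_eq)
  finally show ?thesis .
qed

text \<open>The fibre is the product of the classes of the entries of \<open>us\<close>. Its
  cardinality is the product \<open>c\<close> of their sizes, and every member has weight
  \<open>1 / c\<close>; finite nonempty classes make \<open>c\<close> nonzero.\<close>

lemma sum_weights_fiber:
  assumes "us \<in> tuples m U"
  shows "(\<Sum>xs | xs \<in> tuples m U \<and> map cls xs = map cls us. 1 / (\<Prod>x\<leftarrow>xs. real (card (cls x)))) = 1"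
proof -
  let ?F = "{xs. xs \<in> tuples m U \<and> map cls xs = map cls us}"
  define c where "c = (\<Prod>Y\<leftarrow>map cls us. real (card Y))"
  have us: "u \<in> U" if "u \<in> set us" for u
    using that assms by (auto simp: tuples_def[of m])
  have "c \<noteq> 0"
    using us eq_class_finite_nonempty by (auto simp: c_def prod_list_zero_iff)
  have "?F = {xs. list_all2 (\<in>) xs (map cls us)}"
    using list_all2_mem_eq_class[OF assms] by blast
  then have "card ?F = (\<Prod>Y\<leftarrow>map cls us. card Y)"
    using card_list_all2_mem[of "map cls us"] by simp
  then have "real (card ?F) = c"
    by (simp only: c_def of_nat_prod_list) (simp add: comp_def)
  moreover have "(\<Prod>x\<leftarrow>xs. real (card (cls x))) = c" if "xs \<in> ?F" for xs
  proof -
    have "(\<Prod>x\<leftarrow>xs. real (card (cls x))) = (\<Prod>Y\<leftarrow>map cls xs. real (card Y))"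
      by (simp add: comp_def)
    also have "\<dots> = c"
      using that by (simp only: c_def mem_Collect_eq)
    finally show ?thesis .
  qed
  ultimately show ?thesis
    using \<open>c \<noteq> 0\<close> by simp
qed

text \<open>Every tuple of classes is weighted by 1, spread evenly over its representatives.\<close>

lemma card_solutions_interp:
  assumes "wf_fm \<Lambda> \<phi>" "quantifier_free \<phi>" "fv \<phi> \<subseteq> {..<m}"
  shows "real (card (solutions (interp \<Lambda> I A) m \<phi>)) =
    (\<Sum>xs | xs \<in> tuples m U \<and> sat A ((!) (concat xs)) (interp_fm I \<phi>). 1 / (\<Prod>x\<leftarrow>xs. real (card (cls x))))"
proof -
  let ?S = "{xs. xs \<in> tuples m U \<and> sat A ((!) (concat xs)) (interp_fm I \<phi>)}"
  let ?T = "solutions (interp \<Lambda> I A) m \<phi>"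
  let ?w = "\<lambda>xs. 1 / (\<Prod>x\<leftarrow>xs. real (card (cls x)))"
  have T: "?T = {Xs \<in> tuples m (cls ` U). sat (interp \<Lambda> I A) ((!) Xs) \<phi>}"
    by (simp add: solutions_def[of "interp \<Lambda> I A"] models_def[of "interp \<Lambda> I A"] dom_interp)
  \<comment> \<open>For tuples over \<open>U\<close>, membership in \<open>?S\<close> depends only
    on the classes of the entries, so \<open>?S\<close> is a union of complete fibres.\<close>
  have S: "xs \<in> ?S \<longleftrightarrow> xs \<in> tuples m U \<and> map cls xs \<in> ?T" for xs
  proof -
    have "map cls xs \<in> tuples m (cls ` U)" if "xs \<in> tuples m U"
      using that by (auto simp: tuples_def[of m])
    then show ?thesis
      using sat_interp_fm[OF assms] unfolding T by blast
  qed
  have fin: "finite ?S" "finite ?T"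
    using finite_subset[OF U_subset_D finite_D] by (simp_all add: finite_tuples T)
  have fiber: "sum ?w {xs \<in> ?S. map cls xs = X} = 1" if X: "X \<in> ?T" for X
  proof -
    have "X \<in> lists (cls ` U)" "length X = m"
      using X by (auto simp: T tuples_def[of m])
    then obtain us where "us \<in> lists U" "X = map cls us"
      unfolding lists_image by blast
    with \<open>length X = m\<close> have us: "us \<in> tuples m U" "X = map cls us"
      by (auto simp: tuples_def[of m])
    have "xs \<in> ?S \<and> map cls xs = X \<longleftrightarrow> xs \<in> tuples m U \<and> map cls xs = map cls us" for xs
      unfolding S using us(2) X by metis
    then have "{xs \<in> ?S. map cls xs = X} = {xs. xs \<in> tuples m U \<and> map cls xs = map cls us}"
      by (rule Collect_cong)
    then show ?thesis
      using sum_weights_fiber[OF us(1)] by simp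
  qed
  have "sum ?w ?S = (\<Sum>X\<in>?T. sum ?w {xs \<in> ?S. map cls xs = X})"
    using S by (intro sum.group[symmetric] fin) blast
  also have "\<dots> = real (card ?T)"
    using fiber by simp
  finally show ?thesis by (rule sym)
qed

end

section \<open>Splitting the count along the formulas \<open>\<eta> i\<close>\<close>

theorem theorem8p1:
  fixes \<kappa> :: "'r signature" and \<Lambda> :: "'s signature"
    and A :: "nat \<Rightarrow> ('r, 'a) rel_struct"
    and I :: "('s, 'r) scheme"
    and N :: nat and Q :: "nat \<Rightarrow> real poly" and \<eta> :: "nat \<Rightarrow> 'r fm"
  assumes "is_signature \<kappa>" and "is_signature \<Lambda>"
    and "strongly_polynomial \<kappa> A"
    and "interpretation_scheme \<Lambda> \<kappa> I"
    and "quantifier_free_scheme \<Lambda> I"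
    and "\<forall>i\<in>{1..N}. \<forall>n\<ge>1. poly (Q i) (real n) \<in> \<nat> - {0}"
    and "\<forall>i\<in>{1..N}. formula \<kappa> (expo I) (\<eta> i) \<and> quantifier_free (\<eta> i)"
    and "valid \<kappa> (expo I) (big_or (map \<eta> [1..<Suc N]))"
    and "\<forall>n\<ge>1. \<forall>v\<in>tuples (expo I) (dom (A n)). \<forall>i\<in>{1..N}.
           models (A n) (\<eta> i) v \<longrightarrow> real (card (eq_class I (A n) v)) = poly (Q i) (real n)"
  shows "strongly_polynomial \<Lambda> (\<lambda>n. interp \<Lambda> I (A n))"
proof -
  note sp = assms(3)
  have int: "interpreted_struct \<kappa> \<Lambda> (A n) I" if "n \<ge> 1" for n
    using sp assms(4,5) that by (auto simp: interpreted_struct_def strongly_polynomial_def)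
  have \<eta>: "wf_fm \<kappa> (\<eta> i)" "fv (\<eta> i) = {..<expo I}" "quantifier_free (\<eta> i)" if "i \<in> {1..N}" for i
    using assms(7) that by (auto simp: formula_def)
  have \<eta>_card: "real (card (eq_class I (A n) x)) = poly (Q i) (real n)"
    if "n \<ge> 1" "x \<in> tuples (expo I) (dom (A n))" "i \<in> {1..N}" "models (A n) (\<eta> i) x" for n x i
    using assms(9) that by blast
  \<comment> \<open>The formulas \<open>\<eta> i\<close> may overlap, so a tuple is assigned to the
    first one it satisfies. The formula \<open>\<eta>' i\<close> expresses without quantifiers that
    this first index is \<open>i\<close>.\<close>
  define idx where "idx n x = (LEAST i. i \<in> {1..N} \<and> models (A n) (\<eta> i) x)" for n x
  define \<eta>' where "\<eta>' i = And (\<eta> i) (Neg (big_or (map \<eta> [1..<i])))" for i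
  have \<eta>': "wf_fm \<kappa> (\<eta>' i)" "fv (\<eta>' i) \<subseteq> {..<expo I}" "quantifier_free (\<eta>' i)"
    if "i \<in> {1..N}" for i
    using \<eta> that by (auto simp: \<eta>'_def)
  have idx: "idx n x \<in> {1..N}" "models (A n) (\<eta> (idx n x)) x"
    and idx_eq_iff: "\<And>i. i \<in> {1..N} \<Longrightarrow> idx n x = i \<longleftrightarrow> models (A n) (\<eta>' i) x"
    if n: "n \<ge> 1" and x: "x \<in> tuples (expo I) (dom (A n))" for n x
  proof -
    \<comment> \<open>For \<open>N = 0\<close> the disjunction is \<open>FF\<close>, which has no
      free variables and so need not be a \<open>formula\<close> in \<open>expo I\<close> variables;
      \<open>valid_models\<close> then cannot be applied.\<close>
    have "models (A n) (big_or (map \<eta> [1..<Suc N])) x"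
    proof (cases "N = 0")
      case True
      \<comment> \<open>the empty disjunction fails on a one-element structure\<close>
      have "is_struct \<kappa> \<lparr>dom = {0::nat}, rel = \<lambda>_. {}\<rparr>"
        by (simp add: is_struct_def)
      moreover have "replicate (expo I) 0 \<in> tuples (expo I) (dom \<lparr>dom = {0::nat}, rel = \<lambda>_. {}\<rparr>)"
        by (auto simp: tuples_def)
      ultimately have "models \<lparr>dom = {0::nat}, rel = \<lambda>_. {}\<rparr> (big_or (map \<eta> [1..<Suc N]))
          (replicate (expo I) 0)"
        using assms(8) unfolding valid_def by blast
      then show ?thesis
        using True by (simp add: models_def)
    next
      case False
      have "formula \<kappa> (expo I) (big_or (map \<eta> [1..<Suc N]))"
        using \<eta> False by (auto simp: formula_def simp del: upt_Suc)
      moreover have "quantifier_free (big_or (map \<eta> [1..<Suc N]))"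
        using \<eta> by (auto simp del: upt_Suc)
      moreover have "is_struct \<kappa> (A n)"
        using sp n by (simp add: strongly_polynomial_def)
      ultimately show ?thesis
        using valid_models assms(8) x by blast
    qed
    then have "\<exists>i. i \<in> {1..N} \<and> models (A n) (\<eta> i) x"
      by (auto simp: models_def simp del: upt_Suc)
    then have idx: "idx n x \<in> {1..N} \<and> models (A n) (\<eta> (idx n x)) x"
      unfolding idx_def by (rule LeastI_ex)
    then show "idx n x \<in> {1..N}" "models (A n) (\<eta> (idx n x)) x"
      by auto
    have least: "idx n x \<le> j" if "j \<in> {1..N}" "models (A n) (\<eta> j) x" for j
      unfolding idx_def using that by (intro Least_le) blast
    fix i assume i: "i \<in> {1..N}"
    have "models (A n) (\<eta>' i) x \<longleftrightarrow> models (A n) (\<eta> i) x \<and> (\<forall>j\<in>{1..<i}. \<not> models (A n) (\<eta> j) x)"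
      by (auto simp: \<eta>'_def models_def)
    also have "\<dots> \<longleftrightarrow> idx n x = i"
    proof
      assume *: "models (A n) (\<eta> i) x \<and> (\<forall>j\<in>{1..<i}. \<not> models (A n) (\<eta> j) x)"
      then have "idx n x \<le> i"
        using least i by blast
      moreover have "\<not> idx n x < i"
        using * idx by auto
      ultimately show "idx n x = i" by simp
    next
      assume "idx n x = i"
      then show "models (A n) (\<eta> i) x \<and> (\<forall>j\<in>{1..<i}. \<not> models (A n) (\<eta> j) x)"
        using idx least i by fastforce
    qed
    finally show "idx n x = i \<longleftrightarrow> models (A n) (\<eta>' i) x" by simp
  qed
  have "\<exists>P :: real poly. \<forall>n\<ge>1. real (card (solutions (interp \<Lambda> I (A n)) m \<phi>)) = poly P (real n)"
    if \<phi>: "formula \<Lambda> m \<phi>" "quantifier_free \<phi>" for m \<phi>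
  proof -
    have wf: "wf_fm \<Lambda> \<phi>" and fv: "fv \<phi> \<subseteq> {..<m}"
      using \<phi>(1) by (auto simp: formula_def)
    let ?p = "expo I"
    let ?U = "\<lambda>n. solutions (A n) ?p (rho0 I)"
    let ?S = "\<lambda>n. {xs. xs \<in> tuples m (?U n) \<and> sat (A n) ((!) (concat xs)) (interp_fm I \<phi>)}"
    \<comment> \<open>A vector \<open>v\<close> in \<open>V\<close> prescribes an index for each of
      the \<open>m\<close> entries. \<open>block v j\<close> puts entry \<open>j\<close> in
      \<open>U\<close> with index \<open>v ! j\<close>, \<open>\<psi> v\<close> adds the translation
      of \<open>\<phi>\<close>, and \<open>q v\<close> is the resulting product of class
      sizes.\<close>
    define V where "V = tuples m {1..N}"
    define block where
      "block v j = rename (\<lambda>k. j * ?p + k) (And (rho0 I) (\<eta>' (v ! j)))" for v :: "nat list" and j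
    define \<psi> where "\<psi> v = And (interp_fm I \<phi>) (big_and (map (block v) [0..<m]))" for v
    define q where "q v = (\<Prod>i\<leftarrow>v. Q i)" for v
    have finV: "finite V"
      by (simp add: V_def finite_tuples)
    \<comment> \<open>The syntactic facts about \<open>interp_fm\<close> are proved in the locale,
      which needs a structure; any index \<open>n \<ge> 1\<close> would serve.\<close>
    interpret A1: interpreted_struct \<kappa> \<Lambda> "A 1" I
      using int by simp
    have "\<exists>P :: real poly. \<forall>n\<ge>1. real (card (solutions (A n) (?p * m) (\<psi> v))) = poly P (real n)"
      if "v \<in> V" for v
    proof (rule card_solutions_poly[OF sp])
      have v: "v ! j \<in> {1..N}" if "j < m" for j
        using \<open>v \<in> V\<close> that by (simp add: V_def tuples_iff)
      have b: "quantifier_free (And (rho0 I) (\<eta>' (v ! j)))" "wf_fm \<kappa> (And (rho0 I) (\<eta>' (v ! j)))"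
        "fv (And (rho0 I) (\<eta>' (v ! j))) \<subseteq> {..<?p}" if "j < m" for j
        using A1.rho0_formula \<eta>'[OF v[OF that]] by (simp_all add: formula_def)
      show "wf_fm \<kappa> (\<psi> v)"
        using b A1.wf_fm_interp_fm[OF wf] wf_fm_rename unfolding \<psi>_def block_def by fastforce
      show "quantifier_free (\<psi> v)"
        by (auto simp: \<psi>_def block_def simp del: rename.simps)
      have "fv (block v j) \<subseteq> {..<?p * m}" if "j < m" for j
        unfolding block_def fv_rename[OF b(1)[OF that]]
        using b(3)[OF that] that by (auto simp del: fv.simps intro!: block_index_less)
      then show "fv (\<psi> v) \<subseteq> {..<?p * m}"
        using A1.fv_interp_fm[OF wf \<phi>(2) fv] by (simp add: \<psi>_def UN_subset_iff)
    qed
    then obtain P where P: "\<And>v n. \<lbrakk>v \<in> V; n \<ge> 1\<rbrakk>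
        \<Longrightarrow> real (card (solutions (A n) (?p * m) (\<psi> v))) = poly (P v) (real n)"
      by metis
    have Q_pos: "poly (Q i) (real n) \<noteq> 0" if "i \<in> {1..N}" "n \<ge> 1" for i n
      using assms(6) that by fastforce
    have poly_q: "poly (q v) (real n) = (\<Prod>i\<leftarrow>v. poly (Q i) (real n))" for v n
      by (induction v) (auto simp: q_def)
    have q: "poly (q v) (real n) \<noteq> 0" if "v \<in> V" "n \<ge> 1" for v n
      using that Q_pos by (fastforce simp: poly_q V_def tuples_def prod_list_zero_iff)
    have main: "real (card (solutions (interp \<Lambda> I (A n)) m \<phi>)) =
        (\<Sum>v\<in>V. poly (P v) (real n) / poly (q v) (real n))" if n: "n \<ge> 1" for n
    proof -
      interpret An: interpreted_struct \<kappa> \<Lambda> "A n" I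
        using int n .
      let ?w = "\<lambda>xs. 1 / (\<Prod>x\<leftarrow>xs. real (card (An.cls x)))"
      let ?g = "map (idx n)"
      have D: "x \<in> An.D" if "xs \<in> tuples m An.D" "x \<in> set xs" for x xs
        using that by (auto simp: tuples_def[of m])
      have UD: "xs \<in> tuples m An.D" if "xs \<in> tuples m An.U" for xs
        using that An.U_subset_D by (auto simp: tuples_def[of m])
      have fin: "finite (?S n)"
        using finite_subset[OF An.U_subset_D An.finite_D] by (simp add: finite_tuples)
      have gV: "?g ` ?S n \<subseteq> V"
      proof (intro image_subsetI)
        fix xs assume "xs \<in> ?S n"
        then have "xs \<in> tuples m An.D" using UD by blast
        then show "?g xs \<in> V"
          using D idx(1)[OF n] by (simp add: V_def tuples_iff[of _ m])
      qed
      have "sum ?w {xs \<in> ?S n. ?g xs = v} = poly (P v) (real n) / poly (q v) (real n)"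
        if v: "v \<in> V" for v
      proof -
        let ?F = "{xs \<in> ?S n. ?g xs = v}"
        have vj: "v ! j \<in> {1..N}" if "j < m" for j
          using v that by (simp add: V_def tuples_iff)
        \<comment> \<open>On the part with index vector \<open>v\<close> the weight is constant,
          because an entry of index \<open>i\<close> has a class of size
          \<open>poly (Q i) (real n)\<close>.\<close>
        have "?w xs = 1 / poly (q v) (real n)" if "xs \<in> ?F" for xs
        proof -
          have xs: "xs \<in> tuples m An.D" and g: "map (idx n) xs = v"
            using that UD by auto
          have "map (\<lambda>x. real (card (An.cls x))) xs = map (\<lambda>x. poly (Q (idx n x)) (real n)) xs"
            using \<eta>_card[OF n] idx[OF n] D[OF xs] by simp
          also have "\<dots> = map (\<lambda>i. poly (Q i) (real n)) v"
            by (simp flip: g)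
          finally show ?thesis
            by (simp add: poly_q)
        qed
        then have "sum ?w ?F = real (card ?F) / poly (q v) (real n)"
          by simp
        also have "card ?F = card (solutions (A n) (?p * m) (\<psi> v))"
        proof (rule bij_betw_same_card)
          have sat: "sat (A n) ((!) (concat xs)) (\<psi> v) \<longleftrightarrow> xs \<in> ?F" if xs: "xs \<in> tuples m An.D" for xs
          proof -
            have "sat (A n) ((!) (concat xs)) (block v j) \<longleftrightarrow> xs ! j \<in> An.U \<and> idx n (xs ! j) = v ! j"
              if j: "j < m" for j
            proof -
              have x: "xs ! j \<in> An.D"
                using xs j by (simp add: tuples_iff[of _ m])
              have "sat (A n) ((!) (concat xs)) (block v j)
                  \<longleftrightarrow> models (A n) (And (rho0 I) (\<eta>' (v ! j))) (xs ! j)"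
                unfolding block_def
                using An.rho0_formula \<eta>'[OF vj[OF j]]
                by (intro An.sat_rename_block[OF _ _ xs j]) (simp_all add: formula_def)
              also have "\<dots> \<longleftrightarrow> models (A n) (rho0 I) (xs ! j) \<and> models (A n) (\<eta>' (v ! j)) (xs ! j)"
                by (simp add: models_def)
              finally show ?thesis
                using x idx_eq_iff[OF n x vj[OF j]] by (simp add: solutions_def)
            qed
            then have "sat (A n) ((!) (concat xs)) (\<psi> v) \<longleftrightarrow> sat (A n) ((!) (concat xs)) (interp_fm I \<phi>)
                \<and> (\<forall>j<m. xs ! j \<in> An.U) \<and> (\<forall>j<m. idx n (xs ! j) = v ! j)"
              by (auto simp: \<psi>_def)
            moreover have len: "length xs = m" "length v = m"
              using xs v by (simp_all add: V_def tuples_def)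
            then have "xs \<in> tuples m An.U \<longleftrightarrow> (\<forall>j<m. xs ! j \<in> An.U)"
              "map (idx n) xs = v \<longleftrightarrow> (\<forall>j<m. idx n (xs ! j) = v ! j)"
              by (simp_all add: tuples_iff[of _ m] list_eq_iff_nth_eq)
            ultimately show ?thesis
              by blast
          qed
          \<comment> \<open>By \<open>sat\<close>, the bijection between lists of tuples and long
            tuples restricts to one between \<open>?F\<close> and the solutions of
            \<open>\<psi> v\<close>.\<close>
          have "bij_betw concat {xs \<in> tuples m An.D. xs \<in> ?F}
              {zs \<in> tuples (?p * m) (dom (A n)). sat (A n) ((!) zs) (\<psi> v)}"
            using bij_betw_concat sat by (rule bij_betw_Collect)
          moreover have "{xs \<in> tuples m An.D. xs \<in> ?F} = ?F"
            using UD by blast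
          ultimately show "bij_betw concat ?F (solutions (A n) (?p * m) (\<psi> v))"
            by (simp add: solutions_def[of _ "?p * m"] models_def[of _ "\<psi> v"])
        qed
        also have "real \<dots> = poly (P v) (real n)"
          using P[OF v n] .
        finally show ?thesis .
      qed
      then have "(\<Sum>v\<in>V. sum ?w {xs \<in> ?S n. ?g xs = v})
          = (\<Sum>v\<in>V. poly (P v) (real n) / poly (q v) (real n))"
        by simp
      then show ?thesis
        unfolding sum.group[OF fin finV gV] An.card_solutions_interp[OF wf \<phi>(2) fv] .
    qed
    have "\<exists>R S :: real poly. \<forall>n\<ge>1. poly S (real n) \<noteq> 0 \<and>
        (\<Sum>v\<in>V. poly (P v) (real n) / poly (q v) (real n)) = poly R (real n) / poly S (real n)"
      using finV q by (rule ratfun_sum)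
    then obtain R S :: "real poly" where RS: "\<And>n. n \<ge> 1 \<Longrightarrow> poly S (real n) \<noteq> 0 \<and>
        (\<Sum>v\<in>V. poly (P v) (real n) / poly (q v) (real n)) = poly R (real n) / poly S (real n)"
      by blast
    show ?thesis
    \<comment> \<open>The count is a cardinality, so the rational function takes integer
      values.\<close>
    proof (rule integer_valued_ratfun_is_poly)
      show "real (card (solutions (interp \<Lambda> I (A n)) m \<phi>)) = poly R (real n) / poly S (real n)"
        if "n \<ge> 1" for n
        using main[OF that] RS[OF that] by simp
    qed (use RS in auto)
  qed
  then show ?thesis
    using interpreted_struct.is_struct_interp[OF int] by (simp add: strongly_polynomial_def)
qed

end
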